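(* Let $\Omega$ be a domain in $\mathbb{R}^{m+n}$, $m,n\geq 2$, and let $K\geq 1$. Let $u:\Omega\to[-\infty,+\infty)$ be a Lebesgue measurable function such that (a) for each $y\in\mathbb{R}^n$ the function $\Omega(y)\ni x\mapsto u(x,y)\in[-\infty,+\infty)$ is $1$-quasi-nearly subharmonic, (b) for almost every $x\in\mathbb{R}^m$ the function $\Omega(x)\ni y\mapsto u(x,y)\in[-\infty,+\infty)$ is $K$-quasi-nearly subharmonic n.s., (c) there exists a non-constant permissible function $\psi:[0,+\infty)\to[0,+\infty)$ such that $\psi\circ u^+\in\mathcal{L}^1_{\mathrm{loc}}(\Omega)$. Then $u$ is $K$-quasi-nearly subharmonic n.s. in $\Omega$.
   Context: Points of $\mathbb{R}^{m+n}$ are written $(x,y)$ with $x\in\mathbb{R}^m$, $y\in\mathbb{R}^n$. For $\Omega\subset\mathbb{R}^{m+n}$ put $\Omega(y)=\{x\in\mathbb{R}^m:(x,y)\in\Omega\}$ and $\Omega(x)=\{y\in\mathbb{R}^n:(x,y)\in\Omega\}$ (open, possibly empty or disconnected; definitions below are applied verbatim on them). $m_N$ is Lebesgue measure on $\mathbb{R}^N$, $B^N(x,r)$ the open ball, $\nu_N=m_N(B^N(0,1))$, and $u^+=\max\{u,0\}$. Let $D\subset\mathbb{R}^N$ be open, $N\ge2$, and $K\geq1$. A Lebesgue measurable function $u:D\to[-\infty,+\infty)$ with $u^+\in\mathcal{L}^1_{\mathrm{loc}}(D)$ is: - $K$-quasi-nearly subharmonic if for all $M\geq 0$ and all closed balls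 $\overline{B^N(x,r)}\subset D$, $u_M(x)\leq\frac{K}{\nu_N r^N}\int_{B^N(x,r)}u_M\,dm_N$, where $u_M:=\max\{u,-M\}+M$; - $K$-quasi-nearly subharmonic n.s. (in the narrow sense) if for all $\overline{B^N(x,r)}\subset D$, $u(x)\leq\frac{K}{\nu_N r^N}\int_{B^N(x,r)}u\,dm_N$. A function $\varphi:[0,+\infty)\to[0,+\infty)$ satisfies the $\Delta_2$-condition if there is a constant $C\geq1$ with $\varphi(2t)\leq C\varphi(t)$ for all $t\geq0$. A function $\psi:[0,+\infty)\to[0,+\infty)$ is permissible if there exist an increasing (strictly or not), convex function $\psi_1:[0,+\infty)\to[0,+\infty)$ and a strictly increasing surjection $\psi_2:[0,+\infty)\to[0,+\infty)$ such that $\psi=\psi_2\circ\psi_1$, $\psi_1$ satisfies the $\Delta_2$-condition, $\psi_2^{-1}$ satisfies the $\Delta_2$-condition, and $t\mapsto\psi_2(t)/t$ is quasi-decreasing, i.e. there is $C>0$ with $\psi_2(s)/s\geq C\,\psi_2(t)/t$ for all $0<s\leq t$. *)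

theory Defs
  imports "HOL-Analysis.Analysis"
begin

(* Functions on a set D are total functions on the ambient space, of which only the
   values on D are used. *)

definition L1_loc :: "'a::euclidean_space set \<Rightarrow> ('a \<Rightarrow> real) set" where
  "L1_loc D = {f \<in> borel_measurable (lebesgue_on D).
     \<forall>C. compact C \<and> C \<subseteq> D \<longrightarrow> f absolutely_integrable_on C}"

(* u^+ as a real function; real_of_ereal is faithful because u < \<infinity> on the sets considered. *)
definition pos_part :: "('a \<Rightarrow> ereal) \<Rightarrow> 'a \<Rightarrow> real" where
  "pos_part u z = real_of_ereal (max (u z) 0)"

(* Lebesgue integral of an extended real function over S; e2ennreal truncates negative
   values to 0, so the two terms are the integrals of the positive and negative parts.
   It is only used where the first one is finite, so \<infinity> - \<infinity> does not arise. *)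
definition ereal_integral :: "'a::euclidean_space set \<Rightarrow> ('a \<Rightarrow> ereal) \<Rightarrow> ereal" where
  "ereal_integral S f =
     enn2ereal (\<integral>\<^sup>+ z\<in>S. e2ennreal (f z) \<partial>lebesgue)
     - enn2ereal (\<integral>\<^sup>+ z\<in>S. e2ennreal (- f z) \<partial>lebesgue)"

(* The admissible functions u : D \<rightarrow> [-\<infinity>, \<infinity>) common to both definitions below. *)
definition qns_admissible :: "'a::euclidean_space set \<Rightarrow> ('a \<Rightarrow> ereal) \<Rightarrow> bool" where
  "qns_admissible D u \<longleftrightarrow> open D \<and> (\<forall>z\<in>D. u z < \<infinity>) \<and>
     u \<in> borel_measurable (lebesgue_on D) \<and> pos_part u \<in> L1_loc D"

definition quasi_nearly_subharmonic ::
    "real \<Rightarrow> 'a::euclidean_space set \<Rightarrow> ('a \<Rightarrow> ereal) \<Rightarrow> bool" where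
  "quasi_nearly_subharmonic K D u \<longleftrightarrow> qns_admissible D u \<and>
     (\<forall>M::real. M \<ge> 0 \<longrightarrow> (\<forall>x r. r > 0 \<and> cball x r \<subseteq> D \<longrightarrow>
        (let u\<^sub>M = (\<lambda>z. max (u z) (ereal (- M)) + ereal M)
         in u\<^sub>M x \<le> ereal (K / (measure lebesgue (ball (0::'a) 1) * r ^ DIM('a)))
                   * ereal_integral (ball x r) u\<^sub>M)))"

definition quasi_nearly_subharmonic_ns ::
    "real \<Rightarrow> 'a::euclidean_space set \<Rightarrow> ('a \<Rightarrow> ereal) \<Rightarrow> bool" where
  "quasi_nearly_subharmonic_ns K D u \<longleftrightarrow> qns_admissible D u \<and>
     (\<forall>x r. r > 0 \<and> cball x r \<subseteq> D \<longrightarrow>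
        u x \<le> ereal (K / (measure lebesgue (ball (0::'a) 1) * r ^ DIM('a)))
              * ereal_integral (ball x r) u)"

definition Delta2_condition :: "(real \<Rightarrow> real) \<Rightarrow> bool" where
  "Delta2_condition \<phi> \<longleftrightarrow> (\<exists>C\<ge>1. \<forall>t\<ge>0. \<phi> (2 * t) \<le> C * \<phi> t)"

definition quasi_decreasing :: "(real \<Rightarrow> real) \<Rightarrow> bool" where
  "quasi_decreasing g \<longleftrightarrow> (\<exists>C>0. \<forall>s t. 0 < s \<and> s \<le> t \<longrightarrow> g s \<ge> C * g t)"

definition permissible :: "(real \<Rightarrow> real) \<Rightarrow> bool" where
  "permissible \<psi> \<longleftrightarrow> \<psi> \<in> {0..} \<rightarrow> {0..} \<and>
     (\<exists>\<psi>\<^sub>1 \<psi>\<^sub>2. \<psi>\<^sub>1 \<in> {0..} \<rightarrow> {0..} \<and> mono_on {0..} \<psi>\<^sub>1 \<and> convex_on {0..} \<psi>\<^sub>1 \<and>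
        \<psi>\<^sub>2 ` {0..} = {0..} \<and> strict_mono_on {0..} \<psi>\<^sub>2 \<and>
        (\<forall>t\<ge>0. \<psi> t = \<psi>\<^sub>2 (\<psi>\<^sub>1 t)) \<and>
        Delta2_condition \<psi>\<^sub>1 \<and> Delta2_condition (inv_into {0..} \<psi>\<^sub>2) \<and>
        quasi_decreasing (\<lambda>t. \<psi>\<^sub>2 t / t))"

end

theory Submission
  imports Defs
begin

text \<open>Write \<open>v\<close> for the positive part of \<open>u\<close>. The proof has two halves: \<open>v\<close> is locally bounded, and then
the sub-mean value inequality on a ball follows by slicing the ball in both directions.

Local boundedness. A non-constant permissible function is the composition of an increasing convex function, which
grows at least linearly, with a function whose inverse is doubling, which grows at least like a power.
Hence \<open>t powr p\<close> is dominated by \<open>1 + \<psi> t\<close> for some \<open>p \<in> (0, 1]\<close> (\<open>permissible_power_growth\<close>), and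
\<open>v powr p\<close> is locally integrable. It is not known a priori that \<open>v\<close> is locally integrable jointly in
both variables, but its slices are. A nonnegative integrable function with \<open>w x \<le> K \<cdot> mean of w\<close> on small
balls satisfies the same kind of inequality for \<open>w powr p\<close> (\<open>submean_power\<close>, the inequality of
Hardy--Littlewood and Fefferman--Stein). Applied to the slices in \<open>x\<close> and then to almost all slices in
\<open>y\<close>, it bounds \<open>v powr p\<close> at a point by its integral over a product of two balls, which is finite
(\<open>separately_submean_locally_bounded\<close>).

Slicing. Let \<open>B\<close> be a ball with centre \<open>(x0, y0)\<close> whose closure lies in \<open>\<Omega>\<close>. For almost every \<open>x\<close>, the
slice of \<open>B\<close> over \<open>x\<close> is a ball about \<open>y0\<close>, so the integral of \<open>u (x, y)\<close> over this slice is at least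
\<open>1 / K\<close> times the integral of the constant \<open>u (x, y0)\<close>. Thus \<open>K\<close> times the integral of \<open>u\<close> over \<open>B\<close>
is at least the integral over \<open>B\<close> of the function \<open>(x, y) \<mapsto> u (x, y0)\<close>. Over each \<open>y\<close> the slice of
\<open>B\<close> is a ball about \<open>x0\<close>, and the inequality with constant \<open>1\<close> shows that this integral is at least
\<open>u (x0, y0)\<close> times the volume of \<open>B\<close> (\<open>separately_submean_ball\<close>). No constant is lost; this is
where the constant \<open>1\<close> in the variable \<open>x\<close> is needed.

Since \<open>u\<close> may be \<open>-\<infinity>\<close> and its integral may be \<open>-\<infinity>\<close>, the second half is carried out for the gap
\<open>M - u\<close>, a function with values in \<open>[0, \<infinity>]\<close>, where \<open>M\<close> is an upper bound of \<open>u\<close> on the closed ball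
(\<open>ereal_integral_eq_diff_gap\<close>, \<open>submean_iff_gap\<close>).\<close>

section \<open>Permissible functions dominate a power\<close>

lemma convex_mono_on_linear_growth:
  fixes f :: "real \<Rightarrow> real"
  assumes cvx: "convex_on {0..} f" and mono: "mono_on {0..} f" and nn: "f \<in> {0..} \<rightarrow> {0..}"
    and nc: "\<not> f constant_on {0..}"
  obtains A where "A \<ge> 0" "\<And>t. t \<ge> 0 \<Longrightarrow> t \<le> A * (1 + f t)"
proof -
  obtain s t where st: "0 \<le> s" "s < t" "f s < f t"
  proof -
    obtain a b where ab: "a \<ge> 0" "b \<ge> 0" "f a \<noteq> f b"
      using nc unfolding constant_on_def by (metis atLeast_iff order_refl)
    have "a \<noteq> b" using ab by auto
    then consider "a < b" | "b < a" by linarith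
    then show thesis
    proof cases
      case 1
      then have "f a \<le> f b" using mono ab by (auto simp: mono_on_def)
      then show ?thesis using that[of a b] 1 ab by auto
    next
      case 2
      then have "f b \<le> f a" using mono ab by (auto simp: mono_on_def)
      then show ?thesis using that[of b a] 2 ab by auto
    qed
  qed
  \<comment> \<open>Beyond \<open>t\<close> the graph of \<open>f\<close> lies above the line of slope \<open>m\<close> through \<open>(s, f s)\<close>.\<close>
  define m where "m = (f t - f s) / (t - s)"
  have m: "m > 0" using st by (simp add: m_def)
  have bound: "x \<le> (t + 1 / m) * (1 + f x)" if x: "x \<ge> 0" for x
  proof -
    have fx: "f x \<ge> 0" using nn x by auto
    have "x \<le> t + f x / m"
    proof (cases "x \<le> t")
      case True
      then show ?thesis using fx m by (simp add: add_increasing2)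
    next
      case False
      have fs: "f s \<ge> 0" using nn st by auto
      have "f t \<le> (f x - f s) / (x - s) * (t - s) + f s"
      proof (rule convex_onD_Icc')
        show "convex_on {s..x} f"
          by (rule convex_on_subset[OF cvx]) (use st in auto)
        show "t \<in> {s..x}" using st False by auto
      qed
      then have "m \<le> (f x - f s) / (x - s)"
        using st by (simp add: m_def field_simps)
      then have "m * (x - s) \<le> f x - f s"
        using st False by (simp add: pos_le_divide_eq)
      then have "m * (x - s) \<le> f x" using fs by linarith
      then have "x - s \<le> f x / m" using m by (simp add: field_simps)
      then show ?thesis using st by linarith
    qed
    also have "\<dots> \<le> (t + 1 / m) * (1 + f x)"
      using st m fx by (simp add: algebra_simps)
    finally show ?thesis .
  qed
  show thesis
    by (rule that[of "t + 1 / m"]) (use st m bound in auto)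
qed

lemma Delta2_polynomial_growth:
  fixes f :: "real \<Rightarrow> real"
  assumes D: "Delta2_condition f" and mono: "mono_on {0..} f" and nn: "f \<in> {0..} \<rightarrow> {0..}"
  obtains B k where "B \<ge> 0" "\<And>s. s \<ge> 0 \<Longrightarrow> f s \<le> B * (1 + s) ^ k"
proof -
  obtain C where C: "C \<ge> 1" "\<And>t. t \<ge> 0 \<Longrightarrow> f (2 * t) \<le> C * f t"
    using D unfolding Delta2_condition_def by auto
  obtain k where k: "C \<le> 2 ^ k"
    using real_arch_pow[of 2 C] by (auto intro: less_imp_le)
  have f1: "f 1 \<ge> 0" using nn by auto
  have pow: "f (2 ^ j) \<le> C ^ j * f 1" for j
  proof (induction j)
    case (Suc j)
    have "f (2 ^ Suc j) \<le> C * f (2 ^ j)" using C(2)[of "2 ^ j"] by simp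
    also have "\<dots> \<le> C * (C ^ j * f 1)" using Suc C(1) by (intro mult_left_mono) auto
    finally show ?case by (simp add: mult.assoc)
  qed simp
  have bound: "f s \<le> (f 1 * 2 ^ k) * (1 + s) ^ k" if s: "s \<ge> 0" for s
  proof -
    define j where "j = nat \<lceil>log 2 (1 + s)\<rceil>"
    have l0: "log 2 (1 + s) \<ge> 0" using s by simp
    have j1: "log 2 (1 + s) \<le> real j" and j2: "real j \<le> log 2 (1 + s) + 1"
      using l0 unfolding j_def by linarith+
    have "1 + s \<le> 2 powr real j" using j1 s by (simp add: log_le_iff)
    then have a: "s \<le> 2 ^ j" by (simp add: powr_realpow)
    have "2 powr real j \<le> 2 powr (log 2 (1 + s) + 1)" using j2 by simp
    then have b: "2 ^ j \<le> 2 * (1 + s)" using s by (simp add: powr_realpow powr_add)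
    have "f s \<le> f (2 ^ j)" using mono a s by (auto simp: mono_on_def)
    also have "\<dots> \<le> C ^ j * f 1" by (rule pow)
    also have "\<dots> \<le> (2 ^ k) ^ j * f 1"
      using k C(1) f1 by (intro mult_right_mono power_mono) auto
    also have "\<dots> = (2 ^ j) ^ k * f 1" by (simp add: power_mult[symmetric] mult.commute)
    also have "\<dots> \<le> (2 * (1 + s)) ^ k * f 1"
      using b f1 by (intro mult_right_mono power_mono) auto
    finally show ?thesis by (simp only: power_mult_distrib mult_ac)
  qed
  show thesis
    by (rule that[of "f 1 * 2 ^ k" k]) (use f1 bound in auto)
qed

lemma permissible_power_growth:
  assumes perm: "permissible \<psi>" and nc: "\<not> \<psi> constant_on {0..}"
  obtains A p :: real where "A \<ge> 0" "0 < p" "p \<le> 1"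
    "\<And>t. t \<ge> 0 \<Longrightarrow> t powr p \<le> A * (1 + \<psi> t)"
proof -
  have psi0: "\<psi> t \<ge> 0" if "t \<ge> 0" for t
    using perm that unfolding permissible_def by auto
  obtain f g where f: "f \<in> {0..} \<rightarrow> {0..}" "mono_on {0..} f" "convex_on {0..} f"
    and g: "g ` {0..} = {0..}" "strict_mono_on {0..} g"
    and psi: "\<And>t. t \<ge> 0 \<Longrightarrow> \<psi> t = g (f t)"
    and D: "Delta2_condition (inv_into {0..} g)"
    using perm unfolding permissible_def by blast
  have "\<not> f constant_on {0..}"
  proof
    assume "f constant_on {0..}"
    then obtain c where "\<And>t. t \<ge> 0 \<Longrightarrow> f t = c" unfolding constant_on_def by auto
    then have "\<psi> constant_on {0..}" unfolding constant_on_def using psi by auto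
    then show False using nc by simp
  qed
  then obtain A where A: "A \<ge> 0" "\<And>t. t \<ge> 0 \<Longrightarrow> t \<le> A * (1 + f t)"
    using convex_mono_on_linear_growth[OF f(3,2,1)] by metis
  have inj: "inj_on g {0..}" using g(2) by (rule strict_mono_on_imp_inj_on)
  have invnn: "inv_into {0..} g \<in> {0..} \<rightarrow> {0..}"
    using g(1) inv_into_into[of _ g "{0..}"] by blast
  have invmono: "mono_on {0..} (inv_into {0..} g)"
  proof (rule mono_onI)
    fix r s :: real assume rs: "r \<in> {0..}" "s \<in> {0..}" "r \<le> s"
    show "inv_into {0..} g r \<le> inv_into {0..} g s"
    proof (rule ccontr)
      assume "\<not> ?thesis"
      then have "g (inv_into {0..} g s) < g (inv_into {0..} g r)"
        using g(2) invnn rs unfolding strict_mono_on_def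
        by (metis PiE not_le)
      then show False using rs g(1) by (simp add: f_inv_into_f)
    qed
  qed
  obtain B k where B: "B \<ge> 0" "\<And>s. s \<ge> 0 \<Longrightarrow> inv_into {0..} g s \<le> B * (1 + s) ^ k"
    using Delta2_polynomial_growth[OF D invmono invnn] by metis
  \<comment> \<open>The two growth bounds give \<open>t \<le> A' * (1 + \<psi> t) ^ Suc k\<close>; a root of order \<open>Suc k\<close> is taken.
    The successor keeps \<open>p\<close> defined when \<open>k = 0\<close>.\<close>
  define p where "p = 1 / real (Suc k)"
  define A' where "A' = A * (1 + B)"
  have A': "A' \<ge> 0" using A B by (simp add: A'_def)
  have bound: "t powr p \<le> (A' powr p) * (1 + \<psi> t)" if t: "t \<ge> 0" for t
  proof -
    have ft: "f t \<ge> 0" using f(1) t by auto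
    have "f t = inv_into {0..} g (\<psi> t)" using psi[OF t] inj ft by simp
    also have "\<dots> \<le> B * (1 + \<psi> t) ^ k" using B psi0 t by auto
    also have "\<dots> \<le> B * (1 + \<psi> t) ^ Suc k"
      using B psi0[OF t] by (intro mult_left_mono power_increasing) auto
    finally have 1: "f t \<le> B * (1 + \<psi> t) ^ Suc k" .
    have "1 \<le> (1 + \<psi> t) ^ Suc k" by (rule one_le_power) (use psi0[OF t] in auto)
    then have "1 + f t \<le> (1 + B) * (1 + \<psi> t) ^ Suc k"
      using 1 by (simp only: distrib_right)
    then have "A * (1 + f t) \<le> A * ((1 + B) * (1 + \<psi> t) ^ Suc k)"
      using A(1) by (rule mult_left_mono)
    then have "t \<le> A' * (1 + \<psi> t) ^ Suc k"
      using A(2)[OF t] by (simp only: A'_def mult.assoc)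
    then have "t powr p \<le> (A' * (1 + \<psi> t) ^ Suc k) powr p"
      using t by (intro powr_mono2) (auto simp: p_def)
    also have "\<dots> = A' powr p * ((1 + \<psi> t) powr real (Suc k)) powr p"
      using A' psi0[OF t] by (simp add: powr_mult powr_realpow del: power_Suc of_nat_Suc)
    also have "((1 + \<psi> t) powr real (Suc k)) powr p = 1 + \<psi> t"
      using psi0[OF t] by (simp add: powr_powr p_def)
    finally show ?thesis .
  qed
  show thesis
    by (rule that[of "A' powr p" p]) (use bound in \<open>auto simp: p_def\<close>)
qed

section \<open>Powers of functions with the sub-mean value property\<close>

text \<open>The inequality of Hardy--Littlewood and Fefferman--Stein: the sub-mean value property of \<open>w\<close> on all balls
inside \<open>ball x0 R\<close> passes to \<open>w powr p\<close>, with a constant that does not depend on \<open>w\<close>. The factor \<open>K\<close>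
absorbs the volume of the unit ball. Integrability of \<open>w\<close> itself is needed, but does not enter
the constant.\<close>

lemma submean_power:
  fixes w :: "'a::euclidean_space \<Rightarrow> real"
  assumes R: "R > 0" and p: "0 < p" "p \<le> 1" and K: "K > 0"
    and nn: "\<And>z. w z \<ge> 0"
    and meas: "w \<in> borel_measurable (lebesgue_on (ball x0 R))"
    and fin: "(\<integral>\<^sup>+z\<in>ball x0 R. ennreal (w z) \<partial>lebesgue) < \<infinity>"
    and sub: "\<And>x r. r > 0 \<Longrightarrow> cball x r \<subseteq> ball x0 R \<Longrightarrow>
      ennreal (w x) \<le> ennreal (K / r ^ DIM('a)) * (\<integral>\<^sup>+z\<in>ball x r. ennreal (w z) \<partial>lebesgue)"
  shows "ennreal (w x0 powr p) \<le> ennreal (K * 2 powr (DIM('a) / p) / R ^ DIM('a)) *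
    (\<integral>\<^sup>+z\<in>ball x0 R. ennreal (w z powr p) \<partial>lebesgue)"
proof (cases "(\<integral>\<^sup>+z\<in>ball x0 R. ennreal (w z powr p) \<partial>lebesgue) = \<infinity>")
  case True
  then show ?thesis using K R by (simp add: ennreal_mult_top)
next
  case False
  define N where "N = DIM('a)"
  define e where "e = real N / p"
  define B where "B = ball x0 R"
  define d where "d x = R - dist x0 x" for x
  obtain A where A: "A \<ge> 0" "(\<integral>\<^sup>+z\<in>B. ennreal (w z powr p) \<partial>lebesgue) = ennreal A"
    using False unfolding B_def by (cases "\<integral>\<^sup>+z\<in>ball x0 R. ennreal (w z powr p) \<partial>lebesgue" rule: ennreal_cases) auto
  obtain I where I: "I \<ge> 0" "(\<integral>\<^sup>+z\<in>B. ennreal (w z) \<partial>lebesgue) = ennreal I"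
    using fin unfolding B_def by (cases "\<integral>\<^sup>+z\<in>ball x0 R. ennreal (w z) \<partial>lebesgue" rule: ennreal_cases) auto
  have eN: "e \<ge> real N" using p mult_right_mono[of p 1 "real N"] by (simp add: e_def field_simps)
  have ep: "e * p = real N" using p by (simp add: e_def)
  have d: "d x > 0" "d x \<le> R" if "x \<in> B" for x using that by (auto simp: d_def B_def)
  have half: "cball x (d x / 2) \<subseteq> B" if "x \<in> B" for x
  proof
    fix z assume "z \<in> cball x (d x / 2)"
    moreover have "dist x0 z \<le> dist x0 x + dist x z" by (rule dist_triangle)
    ultimately show "z \<in> B" using that by (auto simp: d_def B_def)
  qed
  have crude: "w x \<le> (K / (d x / 2) ^ N) * I" if x: "x \<in> B" for x
  proof -
    have "ennreal (w x) \<le> ennreal (K / (d x / 2) ^ N) * (\<integral>\<^sup>+z\<in>ball x (d x / 2). ennreal (w z) \<partial>lebesgue)"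
      using sub[of "d x / 2" x] d[OF x] half[OF x] by (simp add: B_def N_def)
    also have "\<dots> \<le> ennreal (K / (d x / 2) ^ N) * (\<integral>\<^sup>+z\<in>B. ennreal (w z) \<partial>lebesgue)"
      using half[OF x] by (intro mult_left_mono nn_integral_mono) (auto split: split_indicator)
    also have "\<dots> = ennreal ((K / (d x / 2) ^ N) * I)"
      using I K d[OF x] by (simp flip: ennreal_mult)
    finally show ?thesis using I K d[OF x] by (simp add: ennreal_le_iff)
  qed
  \<comment> \<open>The exponent \<open>e\<close> makes \<open>S\<close> scale like the \<open>p\<close>-th root of \<open>A\<close>; the supremum is finite because \<open>e \<ge> N\<close>
    and \<open>w\<close> is integrable. Finiteness is what allows division by \<open>S powr (1 - p)\<close> at the end.\<close>
  define S where "S = (SUP x\<in>B. w x * d x powr e)"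
  have bdd: "bdd_above ((\<lambda>x. w x * d x powr e) ` B)"
  proof (rule bdd_aboveI2)
    fix x assume x: "x \<in> B"
    note dx = d[OF x]
    have "w x * d x powr e \<le> (K / (d x / 2) ^ N) * I * d x powr e"
      using crude[OF x] by (intro mult_right_mono) auto
    also have "\<dots> = K * 2 ^ N * I * d x powr (e - N)"
      using dx by (simp add: powr_diff powr_realpow power_divide field_simps)
    also have "\<dots> \<le> K * 2 ^ N * I * R powr (e - N)"
      using dx K I eN by (intro mult_left_mono powr_mono2) auto
    finally show "w x * d x powr e \<le> K * 2 ^ N * I * R powr (e - N)" .
  qed
  have le_S: "w x * d x powr e \<le> S" if "x \<in> B" for x
    unfolding S_def using that bdd by (rule cSUP_upper)
  have x0: "x0 \<in> B" using R by (simp add: B_def)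
  have S0: "S \<ge> 0" using le_S[OF x0] nn[of x0] mult_nonneg_nonneg[OF nn[of x0] powr_ge_zero[of "d x0" e]] by linarith
  have measB: "(\<lambda>z. ennreal (w z powr p) * indicator B z) \<in> borel_measurable lebesgue"
    using meas unfolding B_def
    by (subst borel_measurable_restrict_space_iff_ennreal[symmetric]) auto
  have fine: "w x * d x powr e \<le> K * 2 powr e * A * S powr (1 - p)" if x: "x \<in> B" for x
  proof -
    define r where "r = d x / 2"
    define T where "T = (S * r powr (- e)) powr (1 - p)"
    note dx = d[OF x]
    have r: "r > 0" using dx by (simp add: r_def)
    have T0: "T \<ge> 0" by (simp add: T_def)
    \<comment> \<open>On the ball of radius half the distance to the boundary, \<open>w = w powr (1 - p) * w powr p\<close>,
      and the first factor is controlled by \<open>S\<close>.\<close>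
    have ptw: "w z \<le> T * w z powr p" if z: "z \<in> ball x r" for z
    proof -
      have zB: "z \<in> B" using half[OF x] z by (auto simp: r_def)
      have "dist x0 z \<le> dist x0 x + dist x z" by (rule dist_triangle)
      then have "r \<le> d z" using z by (simp add: d_def r_def field_simps)
      then have "w z * r powr e \<le> w z * d z powr e"
        using nn r p by (intro mult_left_mono powr_mono2) (auto simp: e_def)
      also have "\<dots> \<le> S" by (rule le_S[OF zB])
      finally have "w z \<le> S * r powr (- e)"
        using r by (simp add: powr_minus field_simps)
      then have "w z powr (1 - p) \<le> T" unfolding T_def
        using p nn by (intro powr_mono2) auto
      moreover have "w z = w z powr (1 - p) * w z powr p"
        using nn[of z] by (simp flip: powr_add)
      ultimately show ?thesis by (metis mult_right_mono powr_ge_zero)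
    qed
    have "ennreal (w x) \<le> ennreal (K / r ^ N) * (\<integral>\<^sup>+z\<in>ball x r. ennreal (w z) \<partial>lebesgue)"
      using sub[of r x] r half[OF x] by (simp add: B_def N_def r_def)
    also have "\<dots> \<le> ennreal (K / r ^ N) * (\<integral>\<^sup>+z. ennreal T * (ennreal (w z powr p) * indicator B z) \<partial>lebesgue)"
    proof (intro mult_left_mono nn_integral_mono)
      fix z
      show "ennreal (w z) * indicator (ball x r) z \<le> ennreal T * (ennreal (w z powr p) * indicator B z)"
      proof (cases "z \<in> ball x r")
        case True
        then have "z \<in> B" using half[OF x] by (auto simp: r_def)
        then show ?thesis using ptw[OF True] True T0
          by (simp add: ennreal_mult[symmetric] ennreal_leI)
      qed simp
    qed simp
    also have "\<dots> = ennreal (K / r ^ N * (T * A))"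
      using measB A T0 K r by (simp add: nn_integral_cmult flip: ennreal_mult)
    finally have "w x \<le> K / r ^ N * (T * A)"
      using T0 K r A by (simp add: ennreal_le_iff)
    then have "w x * d x powr e \<le> K / r ^ N * (T * A) * d x powr e"
      by (intro mult_right_mono) auto
    also have "\<dots> = K * 2 powr e * A * S powr (1 - p) * (r powr e * r powr (- e * (1 - p)) / r ^ N)"
    proof -
      have "d x powr e = 2 powr e * r powr e"
        using dx by (simp add: r_def flip: powr_mult)
      moreover have "T = S powr (1 - p) * r powr (- e * (1 - p))"
        using S0 r by (simp add: T_def powr_mult powr_powr)
      ultimately show ?thesis by simp
    qed
    \<comment> \<open>The powers of \<open>r\<close> cancel: this fixes the choice of \<open>e\<close>.\<close>
    also have "r powr e * r powr (- e * (1 - p)) / r ^ N = 1"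
    proof -
      have "r powr e * r powr (- e * (1 - p)) = r powr real N"
        by (simp add: algebra_simps ep flip: powr_add)
      then show ?thesis using r by (simp add: powr_realpow)
    qed
    finally show ?thesis by simp
  qed
  have S_le: "S \<le> K * 2 powr e * A * S powr (1 - p)"
    unfolding S_def by (rule cSUP_least) (use x0 fine in \<open>auto simp: S_def\<close>)
  have Sp: "S powr p \<le> K * 2 powr e * A"
  proof (cases "S = 0")
    case True
    then show ?thesis using K A by simp
  next
    case False
    then have "S powr p * S powr (1 - p) \<le> K * 2 powr e * A * S powr (1 - p)"
      using S_le S0 by (simp flip: powr_add)
    then show ?thesis using False S0 by simp
  qed
  have "w x0 powr p * R ^ N = (w x0 * R powr e) powr p"
    using R nn by (simp add: powr_mult powr_powr ep powr_realpow)
  also have "\<dots> \<le> S powr p"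
    using le_S[OF x0] nn p by (intro powr_mono2) (auto simp: d_def)
  also note Sp
  finally have "w x0 powr p \<le> K * 2 powr e / R ^ N * A"
    using R by (simp add: field_simps)
  then have "ennreal (w x0 powr p) \<le> ennreal (K * 2 powr e / R ^ N) * ennreal A"
    using K R A by (simp add: ennreal_mult[symmetric] ennreal_leI)
  then show ?thesis using A by (simp add: e_def N_def B_def)
qed

section \<open>Lebesgue integrals on products and on subsets\<close>

text \<open>Tonelli's theorem for functions that are Lebesgue measurable, rather than Borel measurable, on the
product: their slices, and the inner integral as a function of \<open>x\<close>, agree almost everywhere with those
of a Borel version. The factor \<open>c\<close> is included because the inner integral is not shown to be
measurable, so that it could not be moved out afterwards.\<close>

lemma nn_integral_lebesgue_prod:
  fixes f :: "'a::euclidean_space \<times> 'b::euclidean_space \<Rightarrow> ennreal"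
  assumes "f \<in> borel_measurable lebesgue"
  shows "(\<integral>\<^sup>+x. c * (\<integral>\<^sup>+y. f (x, y) \<partial>lebesgue) \<partial>lebesgue) = c * (\<integral>\<^sup>+z. f z \<partial>lebesgue)"
proof -
  obtain f' where f': "f' \<in> borel_measurable lborel" "AE z in lborel. f z = f' z"
    using completion_ex_borel_measurable[OF assms] by auto
  have "AE z in lborel \<Otimes>\<^sub>M lborel. f z = f' z" using f'(2) unfolding lborel_prod .
  then have ae: "AE x in lborel. AE y in lborel. f (x, y) = f' (x, y)"
    by (rule lborel_pair.AE_pair)
  have m: "f' \<in> borel_measurable (lborel \<Otimes>\<^sub>M lborel)"
    using f'(1) unfolding lborel_prod .
  have "(\<integral>\<^sup>+x. c * (\<integral>\<^sup>+y. f (x, y) \<partial>lebesgue) \<partial>lebesgue) = (\<integral>\<^sup>+x. c * (\<integral>\<^sup>+y. f (x, y) \<partial>lborel) \<partial>lborel)"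
    by (simp add: nn_integral_completion)
  also have "\<dots> = (\<integral>\<^sup>+x. c * (\<integral>\<^sup>+y. f' (x, y) \<partial>lborel) \<partial>lborel)"
  proof (rule nn_integral_cong_AE)
    show "AE x in lborel. c * (\<integral>\<^sup>+y. f (x, y) \<partial>lborel) = c * (\<integral>\<^sup>+y. f' (x, y) \<partial>lborel)"
      using ae by eventually_elim (simp cong: nn_integral_cong_AE)
  qed
  also have "\<dots> = c * (\<integral>\<^sup>+x. (\<integral>\<^sup>+y. f' (x, y) \<partial>lborel) \<partial>lborel)"
    using lborel.borel_measurable_nn_integral_fst[OF m] by (rule nn_integral_cmult)
  also have "\<dots> = c * (\<integral>\<^sup>+z. f' z \<partial>lborel)"
    using lborel.nn_integral_fst[OF m] by (simp add: lborel_prod)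
  also have "(\<integral>\<^sup>+z. f' z \<partial>lborel) = (\<integral>\<^sup>+z. f z \<partial>lebesgue)"
    using f'(2) by (simp add: nn_integral_completion) (rule nn_integral_cong_AE, auto)
  finally show ?thesis .
qed

lemma borel_measurable_indicator_lebesgue_on:
  fixes f :: "'a::euclidean_space \<Rightarrow> ereal"
  assumes f: "f \<in> borel_measurable (lebesgue_on D)" and h: "h \<in> borel_measurable borel"
    and S: "S \<subseteq> D" "S \<in> sets lebesgue" "D \<in> sets lebesgue"
  shows "(\<lambda>z. (h (f z) :: ennreal) * indicator S z) \<in> borel_measurable lebesgue"
proof -
  have "f \<in> borel_measurable (lebesgue_on S)"
    using f S(1) by (rule measurable_restrict_mono)
  then have "(\<lambda>z. h (f z)) \<in> borel_measurable (lebesgue_on S)"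
    using h by (rule measurable_compose)
  then show ?thesis
    using S by (subst borel_measurable_restrict_space_iff_ennreal[symmetric]) auto
qed

lemma nn_integral_affine_on_set:
  fixes g :: "'a::euclidean_space \<Rightarrow> ennreal"
  assumes g: "(\<lambda>y. g y * indicator S y) \<in> borel_measurable lebesgue" and S: "S \<in> sets lebesgue"
  shows "(\<integral>\<^sup>+y\<in>S. (c * g y + d) \<partial>lebesgue) = c * (\<integral>\<^sup>+y\<in>S. g y \<partial>lebesgue) + d * emeasure lebesgue S"
proof -
  have m: "(\<lambda>y. c * (g y * indicator S y)) \<in> borel_measurable lebesgue"
    by (intro borel_measurable_times_ennreal borel_measurable_const g)
  have m': "(\<lambda>y. d * indicator S y) \<in> borel_measurable lebesgue"
    by (intro borel_measurable_times_ennreal borel_measurable_const borel_measurable_indicator S)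
  have "(\<integral>\<^sup>+y\<in>S. (c * g y + d) \<partial>lebesgue)
      = (\<integral>\<^sup>+y. c * (g y * indicator S y) + d * indicator S y \<partial>lebesgue)"
    by (intro nn_integral_cong) (auto split: split_indicator)
  also have "\<dots> = c * (\<integral>\<^sup>+y\<in>S. g y \<partial>lebesgue) + d * emeasure lebesgue S"
    using nn_integral_add[OF m m'] nn_integral_cmult[OF g] S by (simp add: nn_integral_cmult_indicator)
  finally show ?thesis .
qed

lemma measure_lebesgue_ball:
  fixes x :: "'a::euclidean_space"
  assumes "r \<ge> 0"
  shows "measure lebesgue (ball x r) = measure lebesgue (ball (0::'a) 1) * r ^ DIM('a)"
  using assms by (simp add: content_ball)

lemma measure_lebesgue_ball_pos:
  fixes x :: "'a::euclidean_space"
  assumes "r > 0" shows "measure lebesgue (ball x r) > 0"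
  using assms by (simp add: content_ball)

section \<open>Positive parts of quasi-nearly subharmonic functions\<close>

lemma pos_part_nonneg: "pos_part u z \<ge> 0"
  unfolding pos_part_def by (cases "u z") (auto simp: max_def)

lemma e2ennreal_pos_part:
  assumes "u z < \<infinity>" shows "e2ennreal (u z) = ennreal (pos_part u z)"
  using assms by (cases "u z") (auto simp: pos_part_def max_def e2ennreal_neg ennreal_neg)

lemma le_pos_part:
  assumes "u z < \<infinity>" shows "u z \<le> ereal (pos_part u z)"
  using assms by (cases "u z") (auto simp: pos_part_def max_def)

lemma borel_measurable_pos_part_powr:
  fixes u :: "'a::euclidean_space \<Rightarrow> ereal"
  assumes "u \<in> borel_measurable (lebesgue_on D)" "S \<subseteq> D" "S \<in> sets lebesgue" "D \<in> sets lebesgue"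
  shows "(\<lambda>z. ennreal (pos_part u z powr p) * indicator S z) \<in> borel_measurable lebesgue"
proof -
  have "(\<lambda>a. ennreal (real_of_ereal (max a 0) powr p)) \<in> borel_measurable borel"
    by measurable
  from borel_measurable_indicator_lebesgue_on[OF assms(1) this assms(2-)]
  show ?thesis by (simp add: pos_part_def)
qed

lemma e2ennreal_le_of_le_ereal_integral:
  assumes "a \<le> ereal c * ereal_integral S f" and "c \<ge> 0"
  shows "e2ennreal a \<le> ennreal c * (\<integral>\<^sup>+z\<in>S. e2ennreal (f z) \<partial>lebesgue)"
proof -
  let ?P = "(\<integral>\<^sup>+z\<in>S. e2ennreal (f z) \<partial>lebesgue)"
  have "ereal_integral S f \<le> enn2ereal ?P"
    unfolding ereal_integral_def by (intro ereal_diff_le_self enn2ereal_nonneg)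
  then have "a \<le> ereal c * enn2ereal ?P"
    using assms by (meson ereal_less_eq(5) ereal_mult_left_mono order_trans)
  also have "\<dots> = enn2ereal (ennreal c * ?P)"
    using assms(2) by (simp add: times_ennreal.rep_eq enn2ereal_ennreal)
  finally show ?thesis using e2ennreal_mono by fastforce
qed

text \<open>For \<open>M = 0\<close> the truncation \<open>u\<^sub>M\<close> is the positive part.\<close>

lemma quasi_nearly_subharmonic_pos_part:
  fixes u :: "'a::euclidean_space \<Rightarrow> ereal"
  assumes u: "quasi_nearly_subharmonic K D u" and K: "K \<ge> 0"
    and r: "r > 0" "cball x r \<subseteq> D"
  shows "ennreal (pos_part u x) \<le> ennreal (K / (measure lebesgue (ball (0::'a) 1) * r ^ DIM('a)))
           * (\<integral>\<^sup>+z\<in>ball x r. ennreal (pos_part u z) \<partial>lebesgue)"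
proof -
  have fin: "u z < \<infinity>" if "z \<in> cball x r" for z
    using u r that unfolding quasi_nearly_subharmonic_def qns_admissible_def by auto
  have e: "e2ennreal (max (u z) 0) = ennreal (pos_part u z)" if "z \<in> cball x r" for z
    using fin[OF that] by (cases "u z") (auto simp: pos_part_def max_def e2ennreal_neg ennreal_neg)
  have "max (u x) 0 \<le> ereal (K / (measure lebesgue (ball (0::'a) 1) * r ^ DIM('a)))
              * ereal_integral (ball x r) (\<lambda>z. max (u z) 0)"
  proof -
    have "\<forall>x r. r > 0 \<and> cball x r \<subseteq> D \<longrightarrow> max (u x) (ereal (- 0)) + ereal 0
        \<le> ereal (K / (measure lebesgue (ball (0::'a) 1) * r ^ DIM('a)))
              * ereal_integral (ball x r) (\<lambda>z. max (u z) (ereal (- 0)) + ereal 0)"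
      using u unfolding quasi_nearly_subharmonic_def Let_def by blast
    then show ?thesis using r by (simp add: zero_ereal_def[symmetric])
  qed
  then have "e2ennreal (max (u x) 0) \<le> ennreal (K / (measure lebesgue (ball (0::'a) 1) * r ^ DIM('a)))
              * (\<integral>\<^sup>+z\<in>ball x r. e2ennreal (max (u z) 0) \<partial>lebesgue)"
    using K r by (intro e2ennreal_le_of_le_ereal_integral) auto
  also have "(\<integral>\<^sup>+z\<in>ball x r. e2ennreal (max (u z) 0) \<partial>lebesgue) = (\<integral>\<^sup>+z\<in>ball x r. ennreal (pos_part u z) \<partial>lebesgue)"
    using e by (intro nn_integral_cong) (auto split: split_indicator)
  finally show ?thesis using e[of x] r by simp
qed

lemma quasi_nearly_subharmonic_ns_pos_part:
  fixes u :: "'a::euclidean_space \<Rightarrow> ereal"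
  assumes u: "quasi_nearly_subharmonic_ns K D u" and K: "K \<ge> 0"
    and r: "r > 0" "cball x r \<subseteq> D"
  shows "ennreal (pos_part u x) \<le> ennreal (K / (measure lebesgue (ball (0::'a) 1) * r ^ DIM('a)))
           * (\<integral>\<^sup>+z\<in>ball x r. ennreal (pos_part u z) \<partial>lebesgue)"
proof -
  have fin: "u z < \<infinity>" if "z \<in> cball x r" for z
    using u r that unfolding quasi_nearly_subharmonic_ns_def qns_admissible_def by auto
  have e: "e2ennreal (u z) = ennreal (pos_part u z)" if "z \<in> cball x r" for z
    using fin[OF that] by (rule e2ennreal_pos_part)
  have "e2ennreal (u x) \<le> ennreal (K / (measure lebesgue (ball (0::'a) 1) * r ^ DIM('a)))
              * (\<integral>\<^sup>+z\<in>ball x r. e2ennreal (u z) \<partial>lebesgue)"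
    using u r K unfolding quasi_nearly_subharmonic_ns_def
    by (intro e2ennreal_le_of_le_ereal_integral) auto
  also have "(\<integral>\<^sup>+z\<in>ball x r. e2ennreal (u z) \<partial>lebesgue) = (\<integral>\<^sup>+z\<in>ball x r. ennreal (pos_part u z) \<partial>lebesgue)"
    using e by (intro nn_integral_cong) (auto split: split_indicator)
  finally show ?thesis using e[of x] r by simp
qed

lemma submean_pos_part_powr:
  fixes u :: "'a::euclidean_space \<Rightarrow> ereal"
  assumes adm: "qns_admissible D u" and K: "K > 0" and p: "0 < p" "p \<le> 1"
    and sub: "\<And>x r. r > 0 \<Longrightarrow> cball x r \<subseteq> D \<Longrightarrow>
      ennreal (pos_part u x) \<le> ennreal (K / (measure lebesgue (ball (0::'a) 1) * r ^ DIM('a)))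
           * (\<integral>\<^sup>+z\<in>ball x r. ennreal (pos_part u z) \<partial>lebesgue)"
    and R: "R > 0" "cball x R \<subseteq> D"
  shows "ennreal (pos_part u x powr p) \<le>
    ennreal (K / measure lebesgue (ball (0::'a) 1) * 2 powr (DIM('a) / p) / R ^ DIM('a)) *
    (\<integral>\<^sup>+z\<in>ball x R. ennreal (pos_part u z powr p) \<partial>lebesgue)"
proof (rule submean_power)
  have L1: "pos_part u \<in> L1_loc D" using adm by (simp add: qns_admissible_def)
  have ball: "ball x R \<subseteq> D" using R ball_subset_cball by blast
  show "pos_part u \<in> borel_measurable (lebesgue_on (ball x R))"
    using L1 ball unfolding L1_loc_def by (auto intro: measurable_restrict_mono)
  have "pos_part u absolutely_integrable_on cball x R"
    using L1 R unfolding L1_loc_def by auto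
  then have "(\<integral>\<^sup>+z. ennreal (norm (indicator (cball x R) z *\<^sub>R pos_part u z)) \<partial>lebesgue) < \<infinity>"
    unfolding set_integrable_def integrable_iff_bounded by simp
  moreover have "(\<integral>\<^sup>+z\<in>ball x R. ennreal (pos_part u z) \<partial>lebesgue)
    \<le> (\<integral>\<^sup>+z. ennreal (norm (indicator (cball x R) z *\<^sub>R pos_part u z)) \<partial>lebesgue)"
    by (intro nn_integral_mono) (auto split: split_indicator simp: pos_part_nonneg)
  ultimately show "(\<integral>\<^sup>+z\<in>ball x R. ennreal (pos_part u z) \<partial>lebesgue) < \<infinity>"
    by (rule le_less_trans[rotated])
  show "K / measure lebesgue (ball (0::'a) 1) > 0"
    using K measure_lebesgue_ball_pos[of 1 "0::'a"] by simp
  fix y r assume "0 < (r::real)" "cball y r \<subseteq> ball x R"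
  then show "ennreal (pos_part u y) \<le> ennreal (K / measure lebesgue (ball (0::'a) 1) / r ^ DIM('a)) *
      (\<integral>\<^sup>+z\<in>ball y r. ennreal (pos_part u z) \<partial>lebesgue)"
    using sub[of r y] ball by (simp only: divide_divide_eq_left)
qed (use R p in \<open>auto simp: pos_part_nonneg\<close>)

section \<open>Local boundedness from above\<close>

lemma separately_submean_locally_bounded:
  fixes u :: "'a::euclidean_space \<times> 'b::euclidean_space \<Rightarrow> ereal"
  assumes op: "open \<Omega>" and K: "K > 0" and p: "0 < p" "p \<le> 1"
    and meas: "u \<in> borel_measurable (lebesgue_on \<Omega>)"
    and sub1: "\<And>y. quasi_nearly_subharmonic 1 {x. (x, y) \<in> \<Omega>} (\<lambda>x. u (x, y))"
    and sub2: "AE x in lebesgue. quasi_nearly_subharmonic_ns K {y. (x, y) \<in> \<Omega>} (\<lambda>y. u (x, y))"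
    and int: "\<And>C. compact C \<Longrightarrow> C \<subseteq> \<Omega> \<Longrightarrow> (\<integral>\<^sup>+z\<in>C. ennreal (pos_part u z powr p) \<partial>lebesgue) < \<infinity>"
    and z0: "z0 \<in> \<Omega>"
  shows "\<exists>U L. open U \<and> z0 \<in> U \<and> (\<forall>z\<in>U. pos_part u z \<le> L)"
proof -
  obtain x0 y0 where z0_eq: "z0 = (x0, y0)" by (cases z0)
  obtain e where e: "e > 0" "cball z0 e \<subseteq> \<Omega>" using op z0 open_contains_cball by blast
  define r where "r = e / 4"
  have r: "r > 0" using e by (simp add: r_def)
  define Q where "Q = cball x0 (2 * r) \<times> cball y0 (2 * r)"
  have QO: "Q \<subseteq> \<Omega>"
  proof
    fix z assume "z \<in> Q"
    then obtain x y where z: "z = (x, y)" "dist x0 x \<le> 2 * r" "dist y0 y \<le> 2 * r"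
      by (auto simp: Q_def)
    have "dist z0 z \<le> dist x0 x + dist y0 y"
      unfolding z0_eq z dist_Pair_Pair by (rule sqrt_sum_squares_le_sum) auto
    then have "z \<in> cball z0 e" using z by (simp add: r_def)
    then show "z \<in> \<Omega>" using e by auto
  qed
  have Qc: "compact Q" unfolding Q_def by (intro compact_Times compact_cball)
  define F where "F z = ennreal (pos_part u z powr p) * indicator Q z" for z
  have Fm: "F \<in> borel_measurable lebesgue"
    unfolding F_def using meas QO Qc op
    by (intro borel_measurable_pos_part_powr) (auto intro: lmeasurable_compact fmeasurableD)
  have Ffin: "(\<integral>\<^sup>+z. F z \<partial>lebesgue) < \<infinity>" unfolding F_def by (rule int[OF Qc QO])
  define c1 where "c1 = ennreal (1 / measure lebesgue (ball (0::'a) 1) * 2 powr (DIM('a) / p) / r ^ DIM('a))"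
  define c2 where "c2 = ennreal (K / measure lebesgue (ball (0::'b) 1) * 2 powr (DIM('b) / p) / r ^ DIM('b))"
  define L where "L = enn2real (c1 * (c2 * (\<integral>\<^sup>+z. F z \<partial>lebesgue)))"
  have fin: "c1 * (c2 * (\<integral>\<^sup>+z. F z \<partial>lebesgue)) < top"
    using Ffin by (simp add: ennreal_mult_less_top c1_def c2_def)
  have pp: "pos_part (\<lambda>x. u (x, y)) x = pos_part u (x, y)"
    "pos_part (\<lambda>y. u (x, y)) y = pos_part u (x, y)" for x y by (simp_all add: pos_part_def)
  have bound: "pos_part u (x, y) powr p \<le> L" if x: "x \<in> ball x0 r" and y: "y \<in> ball y0 r" for x y
  proof -
    have xQ: "cball x r \<subseteq> cball x0 (2 * r)" and yQ: "cball y r \<subseteq> cball y0 (2 * r)"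
      using x y r by (auto simp: cball_subset_cball_iff dist_commute)
    have yy: "y \<in> cball y0 (2 * r)" using y r by auto
    \<comment> \<open>The slice bound in \<open>x\<close> holds for every \<open>y\<close>, so almost everywhere in \<open>x'\<close> suffices for the
      slice bound in \<open>y\<close> that follows.\<close>
    have "ennreal (pos_part u (x, y) powr p) \<le> c1 *
        (\<integral>\<^sup>+x'\<in>ball x r. ennreal (pos_part u (x', y) powr p) \<partial>lebesgue)"
      unfolding c1_def
    proof (rule submean_pos_part_powr[where D = "{x. (x, y) \<in> \<Omega>}" and u = "\<lambda>x. u (x, y)", unfolded pp])
      show "qns_admissible {x. (x, y) \<in> \<Omega>} (\<lambda>x. u (x, y))"
        using sub1[of y] by (simp add: quasi_nearly_subharmonic_def)
      show "cball x r \<subseteq> {x. (x, y) \<in> \<Omega>}" using xQ yy QO by (auto simp: Q_def)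
    qed (use quasi_nearly_subharmonic_pos_part[OF sub1[of y], unfolded pp] p r in auto)
    also have "\<dots> \<le> c1 * (\<integral>\<^sup>+x'. c2 * (\<integral>\<^sup>+y'. F (x', y') \<partial>lebesgue) \<partial>lebesgue)"
    proof (intro mult_left_mono nn_integral_mono_AE)
      show "AE x' in lebesgue. ennreal (pos_part u (x', y) powr p) * indicator (ball x r) x'
        \<le> c2 * (\<integral>\<^sup>+y'. F (x', y') \<partial>lebesgue)"
        using sub2
      proof eventually_elim
        case (elim x')
        show ?case
        proof (cases "x' \<in> ball x r")
          case True
          then have x'Q: "x' \<in> cball x0 (2 * r)" by (rule subsetD[OF xQ ball_subset_cball[THEN subsetD]])
          have "ennreal (pos_part u (x', y) powr p) \<le> c2 *
              (\<integral>\<^sup>+y'\<in>ball y r. ennreal (pos_part u (x', y') powr p) \<partial>lebesgue)"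
            unfolding c2_def
          proof (rule submean_pos_part_powr[where D = "{y. (x', y) \<in> \<Omega>}" and u = "\<lambda>y. u (x', y)", unfolded pp])
            show "qns_admissible {y. (x', y) \<in> \<Omega>} (\<lambda>y. u (x', y))"
              using elim by (simp add: quasi_nearly_subharmonic_ns_def)
            show "cball y r \<subseteq> {y. (x', y) \<in> \<Omega>}" using yQ x'Q QO by (auto simp: Q_def)
          qed (use quasi_nearly_subharmonic_ns_pos_part[OF elim, unfolded pp] p r K in auto)
          also have "\<dots> \<le> c2 * (\<integral>\<^sup>+y'. F (x', y') \<partial>lebesgue)"
          proof (intro mult_left_mono nn_integral_mono)
            fix y'
            show "ennreal (pos_part u (x', y') powr p) * indicator (ball y r) y' \<le> F (x', y')"
              using x'Q subsetD[OF yQ, of y'] by (auto simp: F_def Q_def split: split_indicator)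
          qed simp
          finally show ?thesis using True by simp
        qed simp
      qed
    qed simp
    also have "\<dots> = c1 * (c2 * (\<integral>\<^sup>+z. F z \<partial>lebesgue))"
      by (simp only: nn_integral_lebesgue_prod[OF Fm])
    finally have "ennreal (pos_part u (x, y) powr p) \<le> ennreal L"
      using fin by (simp add: L_def)
    then show ?thesis by (simp add: L_def ennreal_le_iff)
  qed
  have "open (ball x0 r \<times> ball y0 r)" by (intro open_Times open_ball)
  moreover have "z0 \<in> ball x0 r \<times> ball y0 r" using r by (simp add: z0_eq)
  moreover have "pos_part u z \<le> L powr (1 / p)" if "z \<in> ball x0 r \<times> ball y0 r" for z
  proof -
    obtain x y where z: "z = (x, y)" by (cases z)
    have "(pos_part u z powr p) powr (1 / p) \<le> L powr (1 / p)"
      using bound[of x y] that p by (intro powr_mono2) (auto simp: z)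
    then show ?thesis using p pos_part_nonneg[of u z] by (simp add: powr_powr)
  qed
  ultimately show ?thesis by blast
qed

lemma locally_bounded_imp_bounded_on_compact:
  fixes f :: "'a::topological_space \<Rightarrow> real"
  assumes "compact C" and loc: "\<And>z. z \<in> C \<Longrightarrow> \<exists>U L. open U \<and> z \<in> U \<and> (\<forall>z\<in>U. f z \<le> L)"
  obtains L where "L \<ge> 0" "\<And>z. z \<in> C \<Longrightarrow> f z \<le> L"
proof -
  obtain U L where UL: "\<And>z. z \<in> C \<Longrightarrow> open (U z) \<and> z \<in> U z \<and> (\<forall>w\<in>U z. f w \<le> L z)"
    using loc by metis
  obtain T where T: "T \<subseteq> C" "finite T" "C \<subseteq> (\<Union>c\<in>T. U c)"
    using compactE_image[OF assms(1), of C U] UL by (metis UN_I subsetI)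
  show thesis
  proof (rule that[of "\<Sum>c\<in>T. \<bar>L c\<bar>"])
    fix z assume "z \<in> C"
    then obtain c where c: "c \<in> T" "z \<in> U c" using T by auto
    then have "f z \<le> L c" using UL T by blast
    also have "\<dots> \<le> \<bar>L c\<bar>" by simp
    also have "\<dots> \<le> (\<Sum>c\<in>T. \<bar>L c\<bar>)" using T c by (intro member_le_sum) auto
    finally show "f z \<le> (\<Sum>c\<in>T. \<bar>L c\<bar>)" .
  qed (simp add: sum_nonneg)
qed

lemma bounded_pos_part_L1_loc:
  fixes u :: "'a::euclidean_space \<Rightarrow> ereal"
  assumes meas: "u \<in> borel_measurable (lebesgue_on D)"
    and bdd: "\<And>C. compact C \<Longrightarrow> C \<subseteq> D \<Longrightarrow> \<exists>L. \<forall>z\<in>C. pos_part u z \<le> L"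
  shows "pos_part u \<in> L1_loc D"
proof -
  have m: "pos_part u \<in> borel_measurable (lebesgue_on D)"
    unfolding pos_part_def[abs_def] using meas by measurable
  have "pos_part u absolutely_integrable_on C" if C: "compact C" "C \<subseteq> D" for C
  proof -
    obtain L where L: "\<And>z. z \<in> C \<Longrightarrow> pos_part u z \<le> L" using bdd[OF C] by blast
    have Cm: "C \<in> lmeasurable" using C(1) by (rule lmeasurable_compact)
    show ?thesis
    proof (rule measurable_bounded_by_integrable_imp_absolutely_integrable)
      show "pos_part u \<in> borel_measurable (lebesgue_on C)"
        using m C(2) by (rule measurable_restrict_mono)
      show "C \<in> sets lebesgue" using Cm by auto
      show "(\<lambda>_. L) integrable_on C" using Cm by (rule integrable_on_const)
    qed (use L in \<open>auto simp: pos_part_nonneg\<close>)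
  qed
  then show ?thesis using m by (simp add: L1_loc_def)
qed

lemma L1_loc_permissible_imp_powr:
  fixes u :: "'a::euclidean_space \<Rightarrow> ereal"
  assumes L1: "\<psi> \<circ> pos_part u \<in> L1_loc D" and A: "A \<ge> 0"
    and growth: "\<And>t. t \<ge> 0 \<Longrightarrow> t powr p \<le> A * (1 + \<psi> t)"
    and C: "compact C" "C \<subseteq> D"
  shows "(\<integral>\<^sup>+z\<in>C. ennreal (pos_part u z powr p) \<partial>lebesgue) < \<infinity>"
proof -
  have "(\<psi> \<circ> pos_part u) absolutely_integrable_on C" using L1 C by (auto simp: L1_loc_def)
  moreover have "(\<lambda>_. 1::real) absolutely_integrable_on C"
    using C(1) by (intro absolutely_integrable_on_const lmeasurable_compact)
  ultimately have "(\<lambda>z. A * (1 + (\<psi> \<circ> pos_part u) z)) absolutely_integrable_on C"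
    by (intro set_integrable_mult_right set_integral_add(1))
  then have "(\<integral>\<^sup>+z. ennreal (norm (indicator C z *\<^sub>R (A * (1 + (\<psi> \<circ> pos_part u) z)))) \<partial>lebesgue) < \<infinity>"
    unfolding set_integrable_def integrable_iff_bounded by simp
  moreover have "(\<integral>\<^sup>+z\<in>C. ennreal (pos_part u z powr p) \<partial>lebesgue) \<le>
    (\<integral>\<^sup>+z. ennreal (norm (indicator C z *\<^sub>R (A * (1 + (\<psi> \<circ> pos_part u) z)))) \<partial>lebesgue)"
  proof (intro nn_integral_mono)
    fix z
    have "pos_part u z powr p \<le> norm (A * (1 + \<psi> (pos_part u z)))"
      using growth[OF pos_part_nonneg, of u z] by simp
    then show "ennreal (pos_part u z powr p) * indicator C z \<le>
        ennreal (norm (indicator C z *\<^sub>R (A * (1 + (\<psi> \<circ> pos_part u) z))))"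
      by (auto intro: ennreal_leI split: split_indicator)
  qed
  ultimately show ?thesis by (rule le_less_trans[rotated])
qed

section \<open>Mean value inequalities in terms of the gap to an upper bound\<close>

lemma e2ennreal_add_gap:
  assumes "a \<le> ereal M" "M \<ge> 0"
  shows "e2ennreal a + e2ennreal (ereal M - a) = ennreal M + e2ennreal (- a)"
proof (cases a)
  case (real r)
  show ?thesis
  proof (cases "r \<ge> 0")
    case True
    then show ?thesis using real assms
      by (simp add: e2ennreal_neg ennreal_neg flip: ennreal_plus)
  next
    case False
    then show ?thesis using real assms
      by (simp add: e2ennreal_neg ennreal_neg flip: ennreal_plus)
  qed
qed (use assms in \<open>auto simp: e2ennreal_neg\<close>)

lemma ereal_integral_eq_diff_gap:
  fixes f :: "'a::euclidean_space \<Rightarrow> ereal"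
  assumes f: "f \<in> borel_measurable (lebesgue_on S)" and S: "S \<in> lmeasurable"
    and M: "\<And>z. z \<in> S \<Longrightarrow> f z \<le> ereal M" "M \<ge> 0"
  shows "ereal_integral S f = ereal (M * measure lebesgue S)
    - enn2ereal (\<integral>\<^sup>+z\<in>S. e2ennreal (ereal M - f z) \<partial>lebesgue)"
proof -
  let ?P = "\<integral>\<^sup>+z\<in>S. e2ennreal (f z) \<partial>lebesgue"
  let ?N = "\<integral>\<^sup>+z\<in>S. e2ennreal (- f z) \<partial>lebesgue"
  let ?G = "\<integral>\<^sup>+z\<in>S. e2ennreal (ereal M - f z) \<partial>lebesgue"
  have Ss: "S \<in> sets lebesgue" using S by auto
  note meas = borel_measurable_indicator_lebesgue_on[OF f _ order_refl Ss Ss]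
  have "?P + ?G = (\<integral>\<^sup>+z. e2ennreal (f z) * indicator S z + e2ennreal (ereal M - f z) * indicator S z \<partial>lebesgue)"
    by (intro nn_integral_add[symmetric] meas) measurable
  also have "\<dots> = (\<integral>\<^sup>+z. ennreal M * indicator S z + e2ennreal (- f z) * indicator S z \<partial>lebesgue)"
    using e2ennreal_add_gap M by (intro nn_integral_cong) (auto split: split_indicator)
  also have "\<dots> = (\<integral>\<^sup>+z. ennreal M * indicator S z \<partial>lebesgue) + ?N"
    using Ss by (intro nn_integral_add meas) measurable
  also have "(\<integral>\<^sup>+z. ennreal M * indicator S z \<partial>lebesgue) = ennreal (M * measure lebesgue S)"
    using S M(2) by (simp add: nn_integral_cmult_indicator emeasure_eq_measure2 ennreal_mult)
  finally have eq: "?P + ?G = ennreal (M * measure lebesgue S) + ?N" .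
  have "?P \<le> (\<integral>\<^sup>+z. ennreal M * indicator S z \<partial>lebesgue)"
  proof (rule nn_integral_mono)
    fix z show "e2ennreal (f z) * indicator S z \<le> ennreal M * indicator S z"
      using e2ennreal_mono[OF M(1)[of z]] by (auto split: split_indicator)
  qed
  also have "\<dots> = ennreal (M * measure lebesgue S)"
    using S M(2) by (simp add: nn_integral_cmult_indicator emeasure_eq_measure2 ennreal_mult)
  finally obtain P where P: "P \<ge> 0" "?P = ennreal P"
    by (metis ennreal_cases ennreal_less_top leD top_greatest)
  have MS: "M * measure lebesgue S \<ge> 0" using M(2) by simp
  show ?thesis
  proof (cases "?N" rule: ennreal_cases)
    case (real n)
    then have "ennreal P + ?G = ennreal (M * measure lebesgue S + n)"
      using eq P MS by simp
    then obtain g where g: "g \<ge> 0" "?G = ennreal g"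
      by (cases "?G" rule: ennreal_cases) (auto simp: ennreal_neq_top[symmetric])
    have "P + g = M * measure lebesgue S + n"
      using eq P g real MS by (simp flip: ennreal_plus)
    then show ?thesis unfolding ereal_integral_def
      using P g real MS by (simp add: enn2ereal_ennreal)
  next
    case top
    then have "ennreal P + ?G = top" using eq P by simp
    then have "?G = top" by (simp add: ennreal_add_eq_top)
    then show ?thesis unfolding ereal_integral_def
      using P top by (simp add: enn2ereal_ennreal)
  qed
qed

text \<open>With \<open>G\<close> the integral of \<open>M - u\<close> over a ball of volume \<open>V\<close> and \<open>a\<close> the value of \<open>u\<close> at its centre, the
sub-mean value inequality with constant \<open>K\<close> becomes an inequality in \<open>[0, \<infinity>]\<close> free of subtraction,
which can be integrated over further variables.\<close>

lemma submean_iff_gap: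
  fixes a :: ereal
  assumes "a \<le> ereal M" "M \<ge> 0" "K > 0" "V > 0"
  shows "a \<le> ereal (K / V) * (ereal (M * V) - enn2ereal G) \<longleftrightarrow>
    ennreal K * G + ennreal (M * V) \<le> ennreal (K * M * V) + ennreal V * e2ennreal (ereal M - a)"
proof (cases G rule: ennreal_cases)
  case (real g)
  note G = real
  show ?thesis
  proof (cases a)
    case (real r)
    have "a \<le> ereal (K / V) * (ereal (M * V) - enn2ereal G) \<longleftrightarrow> r \<le> K / V * (M * V - g)"
      using real G by (simp add: enn2ereal_ennreal)
    also have "\<dots> \<longleftrightarrow> K * g + M * V \<le> K * M * V + V * (M - r)"
      using assms by (simp add: field_simps)
    also have "\<dots> \<longleftrightarrow> ennreal (K * g + M * V) \<le> ennreal (K * M * V + V * (M - r))"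
      using assms real G by (subst ennreal_le_iff) auto
    also have "\<dots> \<longleftrightarrow> ennreal K * G + ennreal (M * V) \<le> ennreal (K * M * V) + ennreal V * e2ennreal (ereal M - a)"
      using assms real G by (simp add: ennreal_mult)
    finally show ?thesis .
  next
    case PInf
    then show ?thesis using assms by simp
  next
    case MInf
    then show ?thesis using assms by (simp add: ennreal_mult_top)
  qed
next
  case top
  show ?thesis
  proof (cases a)
    case (real r)
    then show ?thesis using top assms
      by (simp add: ennreal_mult_top ennreal_mult[symmetric] top_unique flip: ennreal_plus)
  next
    case PInf
    then show ?thesis using assms by simp
  next
    case MInf
    then show ?thesis using assms by (simp add: ennreal_mult_top)
  qed
qed

text \<open>For the constant \<open>1\<close>, quasi-near subharmonicity implies the inequality in the narrow sense: the
truncations are removed by monotone convergence. With the constant \<open>1\<close> the terms in \<open>M\<close> cancel.\<close>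

lemma nearly_subharmonic_gap:
  fixes u :: "'a::euclidean_space \<Rightarrow> ereal"
  assumes u: "quasi_nearly_subharmonic 1 D u" and r: "r > 0" "cball x r \<subseteq> D"
    and M: "\<And>z. z \<in> cball x r \<Longrightarrow> u z \<le> ereal M" "M \<ge> 0"
  shows "(\<integral>\<^sup>+z\<in>ball x r. e2ennreal (ereal M - u z) \<partial>lebesgue)
    \<le> ennreal (measure lebesgue (ball x r)) * e2ennreal (ereal M - u x)"
proof -
  define V where "V = measure lebesgue (ball x r)"
  have V: "V > 0" using r by (simp add: V_def measure_lebesgue_ball_pos)
  define g where "g z = e2ennreal (ereal M - u z)" for z
  have meas: "u \<in> borel_measurable (lebesgue_on (ball x r))"
    using u r ball_subset_cball[of x r] unfolding quasi_nearly_subharmonic_def qns_admissible_def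
    by (meson measurable_restrict_mono order_trans)
  \<comment> \<open>\<open>G n\<close> is the gap \<open>M + n - u\<^sub>n\<close>, where \<open>u\<^sub>n = max u (- n) + n\<close>.\<close>
  define G where "G n z = min (g z) (ennreal (M + real n)) * indicator (ball x r) z" for n z
  have trunc: "(\<integral>\<^sup>+z. G n z \<partial>lebesgue) \<le> ennreal V * g x" for n
  proof -
    define L where "L = real n"
    have L: "L \<ge> 0" by (simp add: L_def)
    define uL where "uL z = max (u z) (ereal (- L)) + ereal L" for z
    have uLM: "uL z \<le> ereal (M + L)" if "z \<in> cball x r" for z
      using M(1)[OF that] M(2) L by (cases "u z") (auto simp: uL_def max_def)
    have gL: "e2ennreal (ereal (M + L) - uL z) = min (g z) (ennreal (M + L))" if "z \<in> cball x r" for z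
      using M(1)[OF that] M(2) L
      by (cases "u z") (auto simp: uL_def g_def max_def min_def ennreal_le_iff top_unique simp del: ennreal_plus)
    have uLmeas: "uL \<in> borel_measurable (lebesgue_on (ball x r))"
      unfolding uL_def using meas by measurable
    have "\<forall>M\<ge>0. \<forall>x r. r > 0 \<and> cball x r \<subseteq> D \<longrightarrow> max (u x) (ereal (- M)) + ereal M
        \<le> ereal (1 / (measure lebesgue (ball (0::'a) 1) * r ^ DIM('a)))
              * ereal_integral (ball x r) (\<lambda>z. max (u z) (ereal (- M)) + ereal M)"
      using u unfolding quasi_nearly_subharmonic_def Let_def by blast
    then have "uL x \<le> ereal (1 / V) * ereal_integral (ball x r) uL"
      unfolding V_def uL_def using r L by (subst measure_lebesgue_ball) auto
    also have "ereal_integral (ball x r) uL = ereal ((M + L) * V)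
        - enn2ereal (\<integral>\<^sup>+z\<in>ball x r. e2ennreal (ereal (M + L) - uL z) \<partial>lebesgue)"
      unfolding V_def using uLM M(2) L by (intro ereal_integral_eq_diff_gap uLmeas) auto
    also have "(\<integral>\<^sup>+z\<in>ball x r. e2ennreal (ereal (M + L) - uL z) \<partial>lebesgue) = (\<integral>\<^sup>+z. G n z \<partial>lebesgue)"
      using gL by (intro nn_integral_cong) (auto simp: G_def L_def split: split_indicator)
    finally have "ennreal 1 * (\<integral>\<^sup>+z. G n z \<partial>lebesgue) + ennreal ((M + L) * V)
      \<le> ennreal (1 * (M + L) * V) + ennreal V * e2ennreal (ereal (M + L) - uL x)"
      by (subst (asm) submean_iff_gap) (use uLM[of x] r M(2) L V in auto)
    then have "(\<integral>\<^sup>+z. G n z \<partial>lebesgue) \<le> ennreal V * e2ennreal (ereal (M + L) - uL x)"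
      by (simp add: add.commute[of "integral\<^sup>N lebesgue (G n)"])
    also have "\<dots> \<le> ennreal V * g x"
      using gL[of x] r by (intro mult_left_mono) auto
    finally show ?thesis .
  qed
  have "(\<integral>\<^sup>+z\<in>ball x r. g z \<partial>lebesgue) = (\<integral>\<^sup>+z. (SUP n. G n z) \<partial>lebesgue)"
  proof (intro nn_integral_cong)
    fix z
    have "(\<lambda>n. min (g z) (ennreal (M + real n))) \<longlonglongrightarrow> min (g z) top"
    proof (intro tendsto_min tendsto_const)
      have "filterlim (\<lambda>n. M + real n) at_top sequentially"
        by (intro filterlim_tendsto_add_at_top[OF tendsto_const] filterlim_real_sequentially)
      then show "(\<lambda>n. ennreal (M + real n)) \<longlonglongrightarrow> top"
        by (simp only: ennreal_tendsto_top_eq_at_top)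
    qed
    then have "(\<lambda>n. min (g z) (ennreal (M + real n))) \<longlonglongrightarrow> g z" by simp
    moreover have "incseq (\<lambda>n. min (g z) (ennreal (M + real n)))"
      by (auto simp: incseq_def min_le_iff_disj intro!: min.mono ennreal_leI)
    ultimately have "(SUP n. min (g z) (ennreal (M + real n))) = g z"
      using LIMSEQ_SUP LIMSEQ_unique by blast
    then show "g z * indicator (ball x r) z = (SUP n. G n z)"
      by (auto simp: G_def split: split_indicator)
  qed
  also have "\<dots> = (SUP n. \<integral>\<^sup>+z. G n z \<partial>lebesgue)"
  proof (rule nn_integral_monotone_convergence_SUP)
    show "incseq G"
      unfolding G_def incseq_def le_fun_def
      by (auto split: split_indicator simp: min_le_iff_disj intro!: ennreal_leI)
    show "G n \<in> borel_measurable lebesgue" for n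
      unfolding G_def g_def
      by (rule borel_measurable_indicator_lebesgue_on[OF meas]) auto
  qed
  also have "\<dots> \<le> ennreal V * g x" by (intro SUP_least trunc)
  finally show ?thesis by (simp add: V_def g_def)
qed

section \<open>Slicing a ball in the product\<close>

lemma mem_ball_Pair_iff:
  "(x, y) \<in> ball (x0, y0) R \<longleftrightarrow> R > 0 \<and> y \<in> ball y0 (sqrt (R\<^sup>2 - (dist x0 x)\<^sup>2))"
  "(x, y) \<in> ball (x0, y0) R \<longleftrightarrow> R > 0 \<and> x \<in> ball x0 (sqrt (R\<^sup>2 - (dist y0 y)\<^sup>2))"
proof -
  have *: "sqrt (a\<^sup>2 + b\<^sup>2) < R \<longleftrightarrow> R > 0 \<and> b < sqrt (R\<^sup>2 - a\<^sup>2)" if "a \<ge> 0" "b \<ge> 0" for a b :: real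
  proof (cases "R > 0")
    case True
    then have "sqrt (a\<^sup>2 + b\<^sup>2) < R \<longleftrightarrow> a\<^sup>2 + b\<^sup>2 < R\<^sup>2"
      by (metis abs_of_pos real_sqrt_abs real_sqrt_less_iff)
    also have "\<dots> \<longleftrightarrow> b\<^sup>2 < R\<^sup>2 - a\<^sup>2" by auto
    also have "\<dots> \<longleftrightarrow> b < sqrt (R\<^sup>2 - a\<^sup>2)"
      using that by (metis abs_of_nonneg real_sqrt_abs real_sqrt_less_iff)
    finally show ?thesis using True by simp
  next
    case False
    have "sqrt (a\<^sup>2 + b\<^sup>2) \<ge> 0" by simp
    then show ?thesis using False by linarith
  qed
  show "(x, y) \<in> ball (x0, y0) R \<longleftrightarrow> R > 0 \<and> y \<in> ball y0 (sqrt (R\<^sup>2 - (dist x0 x)\<^sup>2))"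
    by (simp add: dist_Pair_Pair *)
  show "(x, y) \<in> ball (x0, y0) R \<longleftrightarrow> R > 0 \<and> x \<in> ball x0 (sqrt (R\<^sup>2 - (dist y0 y)\<^sup>2))"
    using *[of "dist y0 y" "dist x0 x"] by (simp add: dist_Pair_Pair add.commute)
qed

lemma mem_cball_PairI:
  assumes "dist x0 x \<le> a" "dist y0 y \<le> b" "a\<^sup>2 + b\<^sup>2 \<le> R\<^sup>2" "R \<ge> 0"
  shows "(x, y) \<in> cball (x0, y0) R"
proof -
  have "(dist x0 x)\<^sup>2 + (dist y0 y)\<^sup>2 \<le> a\<^sup>2 + b\<^sup>2"
    using assms by (intro add_mono power_mono) auto
  then have "sqrt ((dist x0 x)\<^sup>2 + (dist y0 y)\<^sup>2) \<le> R"
    using assms by (intro real_le_lsqrt) auto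
  then show ?thesis by (simp add: dist_Pair_Pair)
qed

lemma separately_submean_ball:
  fixes u :: "'a::euclidean_space \<times> 'b::euclidean_space \<Rightarrow> ereal"
  assumes op: "open \<Omega>" and K: "K > 0"
    and meas: "u \<in> borel_measurable (lebesgue_on \<Omega>)"
    and sub1: "\<And>y. quasi_nearly_subharmonic 1 {x. (x, y) \<in> \<Omega>} (\<lambda>x. u (x, y))"
    and sub2: "AE x in lebesgue. quasi_nearly_subharmonic_ns K {y. (x, y) \<in> \<Omega>} (\<lambda>y. u (x, y))"
    and R: "R > 0" "cball z0 R \<subseteq> \<Omega>"
    and M: "M \<ge> 0" "\<And>z. z \<in> cball z0 R \<Longrightarrow> u z \<le> ereal M"
  shows "u z0 \<le> ereal (K / measure lebesgue (ball z0 R)) * ereal_integral (ball z0 R) u"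
proof -
  obtain x0 y0 where z0: "z0 = (x0, y0)" by (cases z0)
  define B where "B = ball z0 R"
  define V where "V = measure lebesgue B"
  define g where "g z = e2ennreal (ereal M - u z)" for z
  \<comment> \<open>Radii of the slices of \<open>B\<close> over \<open>x\<close> and over \<open>y\<close>; where the radicand is negative, so is the
    square root, and the slice is the empty ball.\<close>
  define \<rho> where "\<rho> x = sqrt (R\<^sup>2 - (dist x0 x)\<^sup>2)" for x
  define \<sigma> where "\<sigma> y = sqrt (R\<^sup>2 - (dist y0 y)\<^sup>2)" for y
  have V: "V > 0" using R by (simp add: V_def B_def measure_lebesgue_ball_pos)
  have BO: "B \<subseteq> \<Omega>" using R ball_subset_cball unfolding B_def by blast
  have B\<rho>: "(x, y) \<in> B \<longleftrightarrow> y \<in> ball y0 (\<rho> x)" and B\<sigma>: "(x, y) \<in> B \<longleftrightarrow> x \<in> ball x0 (\<sigma> y)" for x y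
    using mem_ball_Pair_iff[of x y x0 y0 R] R by (simp_all add: B_def z0 \<rho>_def \<sigma>_def)
  have sl\<rho>: "(x, y) \<in> cball z0 R" if "\<rho> x > 0" "y \<in> cball y0 (\<rho> x)" for x y
    unfolding z0
  proof (rule mem_cball_PairI)
    show "(dist x0 x)\<^sup>2 + (\<rho> x)\<^sup>2 \<le> R\<^sup>2" using that by (simp add: \<rho>_def)
  qed (use that R in auto)
  have sl\<sigma>: "(x, y0) \<in> cball z0 R" if "\<sigma> y > 0" "x \<in> cball x0 (\<sigma> y)" for x y
    unfolding z0
  proof (rule mem_cball_PairI)
    show "(\<sigma> y)\<^sup>2 + 0\<^sup>2 \<le> R\<^sup>2" using that by (simp add: \<sigma>_def)
  qed (use that R in auto)
  have y0_slice: "(x, y0) \<in> cball z0 R" if "x \<in> ball x0 R" for x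
    using that by (simp add: z0 dist_Pair_Pair)
  define c0 where "c0 = ennreal (K * M) + g z0"
  \<comment> \<open>\<open>h\<close> carries the values of \<open>u\<close> on the slice \<open>y = y0\<close> only. It is replaced by a Borel version \<open>h'\<close>,
    so that the integrand \<open>h' x * indicator B (x, y)\<close> below is Borel on the product.\<close>
  define h where "h x = (ennreal (K * M) + g (x, y0)) * indicator (ball x0 R) x" for x
  have slice_open: "open {x. (x, y0) \<in> \<Omega>}"
    using sub1[of y0] by (simp add: quasi_nearly_subharmonic_def qns_admissible_def)
  have slice_meas: "(\<lambda>x. u (x, y0)) \<in> borel_measurable (lebesgue_on {x. (x, y0) \<in> \<Omega>})"
    using sub1[of y0] by (simp add: quasi_nearly_subharmonic_def qns_admissible_def)
  have slice_sub: "ball x0 R \<subseteq> {x. (x, y0) \<in> \<Omega>}" using y0_slice R by auto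
  have gs_meas: "(\<lambda>x. g (x, y0) * indicator S x) \<in> borel_measurable lebesgue"
    if "S \<subseteq> ball x0 R" "S \<in> sets lebesgue" for S
    unfolding g_def
    by (rule borel_measurable_indicator_lebesgue_on[OF slice_meas])
       (use that slice_sub slice_open in auto)
  have h_meas: "h \<in> borel_measurable lebesgue"
    unfolding h_def distrib_right
    by (intro borel_measurable_add gs_meas borel_measurable_times_ennreal borel_measurable_const borel_measurable_indicator) auto
  obtain h' where h': "h' \<in> borel_measurable lborel" "AE x in lborel. h x = h' x"
    using completion_ex_borel_measurable[OF h_meas] by auto
  define f where "f z = (ennreal K * g z + ennreal M) * indicator B z" for z
  have g_meas: "(\<lambda>z. g z * indicator B z) \<in> borel_measurable lebesgue"
    unfolding g_def by (rule borel_measurable_indicator_lebesgue_on[OF meas]) (use BO op in \<open>auto simp: B_def\<close>)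
  have B_meas: "B \<in> sets lebesgue" by (simp add: B_def)
  have f_meas: "f \<in> borel_measurable lebesgue"
  proof -
    have "f = (\<lambda>z. ennreal K * (g z * indicator B z) + ennreal M * indicator B z)"
      by (auto simp: f_def split: split_indicator)
    also have "\<dots> \<in> borel_measurable lebesgue"
      using B_meas
      by (intro borel_measurable_add borel_measurable_times_ennreal borel_measurable_const
            borel_measurable_indicator g_meas)
    finally show ?thesis .
  qed
  have eV: "emeasure lebesgue B = ennreal V"
    unfolding V_def B_def by (intro emeasure_eq_measure2) simp
  have f_int: "(\<integral>\<^sup>+z. f z \<partial>lebesgue) = ennreal K * (\<integral>\<^sup>+z\<in>B. g z \<partial>lebesgue) + ennreal (M * V)"
    unfolding f_def using M V by (simp add: nn_integral_affine_on_set[OF g_meas B_meas] eV ennreal_mult)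
  \<comment> \<open>Sub-mean values in \<open>y\<close> on the slices of \<open>B\<close> bound the integral of \<open>f\<close> by that of
    \<open>(x, y) \<mapsto> h x\<close> over \<open>B\<close>.\<close>
  have vertical: "AE x in lebesgue. (\<integral>\<^sup>+y. f (x, y) \<partial>lebesgue) \<le> (\<integral>\<^sup>+y. h x * indicator B (x, y) \<partial>lborel)"
    using sub2
  proof eventually_elim
    case (elim x)
    show ?case
    proof (cases "\<rho> x > 0")
      case False
      then have "(x, y) \<notin> B" for y
        unfolding B\<rho> mem_ball using zero_le_dist[of y0 y] by linarith
      then show ?thesis by (simp add: f_def)
    next
      case True
      define W where "W = measure lebesgue (ball y0 (\<rho> x))"
      have W: "W > 0" using True by (simp add: W_def measure_lebesgue_ball_pos)
      have eW: "emeasure lebesgue (ball y0 (\<rho> x)) = ennreal W"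
        unfolding W_def by (intro emeasure_eq_measure2) simp
      have x_in: "x \<in> ball x0 R"
        using True R by (simp add: \<rho>_def) (metis abs_le_square_iff abs_of_nonneg abs_of_pos not_le zero_le_dist)
      have sub: "cball y0 (\<rho> x) \<subseteq> {y. (x, y) \<in> \<Omega>}" using sl\<rho>[OF True] R by auto
      have sm: "(\<lambda>y. u (x, y)) \<in> borel_measurable (lebesgue_on (ball y0 (\<rho> x)))"
      proof (rule measurable_restrict_mono)
        show "(\<lambda>y. u (x, y)) \<in> borel_measurable (lebesgue_on {y. (x, y) \<in> \<Omega>})"
          using elim by (simp add: quasi_nearly_subharmonic_ns_def qns_admissible_def)
        show "ball y0 (\<rho> x) \<subseteq> {y. (x, y) \<in> \<Omega>}" using sub ball_subset_cball by blast
      qed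
      have uM: "u (x, y) \<le> ereal M" if "y \<in> cball y0 (\<rho> x)" for y
        using M(2) sl\<rho>[OF True that] by blast
      have y0_in: "y0 \<in> cball y0 (\<rho> x)" using True by simp
      have "u (x, y0) \<le> ereal (K / W) * ereal_integral (ball y0 (\<rho> x)) (\<lambda>y. u (x, y))"
        using elim True sub unfolding quasi_nearly_subharmonic_ns_def W_def
        by (subst measure_lebesgue_ball) auto
      also have "ereal_integral (ball y0 (\<rho> x)) (\<lambda>y. u (x, y)) = ereal (M * W)
          - enn2ereal (\<integral>\<^sup>+y\<in>ball y0 (\<rho> x). e2ennreal (ereal M - u (x, y)) \<partial>lebesgue)"
        unfolding W_def using uM M(1) sm by (intro ereal_integral_eq_diff_gap) auto
      finally have *: "ennreal K * (\<integral>\<^sup>+y\<in>ball y0 (\<rho> x). g (x, y) \<partial>lebesgue) + ennreal (M * W)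
          \<le> ennreal (K * M * W) + ennreal W * g (x, y0)"
        unfolding g_def
        by (subst (asm) submean_iff_gap) (use uM[OF y0_in] M(1) K W in auto)
      have gm: "(\<lambda>y. g (x, y) * indicator (ball y0 (\<rho> x)) y) \<in> borel_measurable lebesgue"
        unfolding g_def by (rule borel_measurable_indicator_lebesgue_on[OF sm]) auto
      have "(\<integral>\<^sup>+y. f (x, y) \<partial>lebesgue)
          = (\<integral>\<^sup>+y\<in>ball y0 (\<rho> x). (ennreal K * g (x, y) + ennreal M) \<partial>lebesgue)"
        unfolding f_def by (intro nn_integral_cong) (auto simp: B\<rho> split: split_indicator)
      also have "\<dots> = ennreal K * (\<integral>\<^sup>+y\<in>ball y0 (\<rho> x). g (x, y) \<partial>lebesgue) + ennreal (M * W)"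
        using M W by (subst nn_integral_affine_on_set[OF gm]) (simp_all add: eW ennreal_mult)
      also note *
      also have "ennreal (K * M * W) + ennreal W * g (x, y0) = h x * ennreal W"
        using x_in K M W by (simp add: h_def ennreal_mult algebra_simps)
      also have "\<dots> = (\<integral>\<^sup>+y. h x * indicator (ball y0 (\<rho> x)) y \<partial>lebesgue)"
        by (simp add: nn_integral_cmult_indicator eW)
      also have "\<dots> = (\<integral>\<^sup>+y. h x * indicator B (x, y) \<partial>lborel)"
        by (simp add: nn_integral_completion B\<rho> indicator_def)
      finally show ?thesis .
    qed
  qed
  \<comment> \<open>Slicing \<open>B\<close> in the other direction, each slice is a ball about \<open>x0\<close>, where the constant \<open>1\<close> applies.\<close>
  have horizontal: "(\<integral>\<^sup>+x. h' x * indicator B (x, y) \<partial>lborel) \<le> (\<integral>\<^sup>+x. c0 * indicator B (x, y) \<partial>lborel)" for y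
  proof (cases "\<sigma> y > 0")
    case False
    then have "(x, y) \<notin> B" for x
      unfolding B\<sigma> mem_ball using zero_le_dist[of x0 x] by linarith
    then show ?thesis by simp
  next
    case True
    define W where "W = measure lebesgue (ball x0 (\<sigma> y))"
    have W: "W > 0" using True by (simp add: W_def measure_lebesgue_ball_pos)
    have eW: "emeasure lebesgue (ball x0 (\<sigma> y)) = ennreal W"
      unfolding W_def by (intro emeasure_eq_measure2) simp
    have "\<sigma> y \<le> R" using R unfolding \<sigma>_def by (intro real_le_lsqrt) auto
    then have bs: "ball x0 (\<sigma> y) \<subseteq> ball x0 R" by auto
    have "(\<integral>\<^sup>+x. h' x * indicator B (x, y) \<partial>lborel) = (\<integral>\<^sup>+x. h x * indicator B (x, y) \<partial>lborel)"
      using h'(2) by (intro nn_integral_cong_AE) (auto elim: eventually_mono)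
    also have "\<dots> = (\<integral>\<^sup>+x\<in>ball x0 (\<sigma> y). (1 * g (x, y0) + ennreal (K * M)) \<partial>lebesgue)"
      unfolding nn_integral_completion
      by (intro nn_integral_cong) (use bs in \<open>auto simp: h_def B\<sigma> split: split_indicator\<close>)
    also have "\<dots> = ennreal (K * M) * ennreal W + (\<integral>\<^sup>+x\<in>ball x0 (\<sigma> y). g (x, y0) \<partial>lebesgue)"
      by (subst nn_integral_affine_on_set[OF gs_meas[OF bs]]) (simp_all add: eW add.commute)
    also have "(\<integral>\<^sup>+x\<in>ball x0 (\<sigma> y). g (x, y0) \<partial>lebesgue) \<le> ennreal W * g (x0, y0)"
      unfolding W_def g_def
      by (rule nearly_subharmonic_gap[OF sub1[of y0]]) (use True sl\<sigma>[OF True] R M in auto)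
    also have "ennreal (K * M) * ennreal W + ennreal W * g (x0, y0) = c0 * ennreal W"
      by (simp add: c0_def z0 algebra_simps)
    also have "\<dots> = (\<integral>\<^sup>+x. c0 * indicator (ball x0 (\<sigma> y)) x \<partial>lebesgue)"
      by (simp add: nn_integral_cmult_indicator eW)
    also have "\<dots> = (\<integral>\<^sup>+x. c0 * indicator B (x, y) \<partial>lborel)"
      by (simp add: nn_integral_completion B\<sigma> indicator_def)
    finally show ?thesis by (simp add: add_left_mono)
  qed
  have Bp: "B \<in> sets (lborel \<Otimes>\<^sub>M lborel)" unfolding lborel_prod by (simp add: B_def)
  have m1: "(\<lambda>z. h' (fst z) * indicator B z) \<in> borel_measurable (lborel \<Otimes>\<^sub>M lborel)"
    using h'(1) Bp by measurable
  have m2: "(\<lambda>z. c0 * indicator B z) \<in> borel_measurable (lborel \<Otimes>\<^sub>M lborel)"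
    using Bp by measurable
  have "ennreal K * (\<integral>\<^sup>+z\<in>B. g z \<partial>lebesgue) + ennreal (M * V) = (\<integral>\<^sup>+x. (\<integral>\<^sup>+y. f (x, y) \<partial>lebesgue) \<partial>lebesgue)"
    using nn_integral_lebesgue_prod[OF f_meas, of 1] f_int by simp
  also have "\<dots> \<le> (\<integral>\<^sup>+x. (\<integral>\<^sup>+y. h x * indicator B (x, y) \<partial>lborel) \<partial>lebesgue)"
    by (rule nn_integral_mono_AE[OF vertical])
  also have "\<dots> = (\<integral>\<^sup>+x. (\<integral>\<^sup>+y. h' x * indicator B (x, y) \<partial>lborel) \<partial>lborel)"
    unfolding nn_integral_completion
    using h'(2) by (intro nn_integral_cong_AE) (auto elim: eventually_mono)
  also have "\<dots> = (\<integral>\<^sup>+y. (\<integral>\<^sup>+x. h' x * indicator B (x, y) \<partial>lborel) \<partial>lborel)"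
    using lborel.nn_integral_fst[OF m1] lborel_pair.nn_integral_snd[OF m1] by simp
  also have "\<dots> \<le> (\<integral>\<^sup>+y. (\<integral>\<^sup>+x. c0 * indicator B (x, y) \<partial>lborel) \<partial>lborel)"
    by (intro nn_integral_mono horizontal)
  also have "\<dots> = (\<integral>\<^sup>+z. c0 * indicator B z \<partial>lborel)"
    using lborel_pair.nn_integral_snd[OF m2] unfolding lborel_prod by simp
  also have "\<dots> = c0 * emeasure lebesgue B"
    using B_def by (simp add: nn_integral_cmult_indicator)
  also note eV
  also have "c0 * ennreal V = ennreal (K * M * V) + ennreal V * g z0"
    using K M V by (simp add: c0_def ennreal_mult algebra_simps)
  finally have *: "ennreal K * (\<integral>\<^sup>+z\<in>B. g z \<partial>lebesgue) + ennreal (M * V)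
    \<le> ennreal (K * M * V) + ennreal V * g z0" .
  have int: "ereal_integral B u = ereal (M * V) - enn2ereal (\<integral>\<^sup>+z\<in>B. e2ennreal (ereal M - u z) \<partial>lebesgue)"
    unfolding V_def
  proof (rule ereal_integral_eq_diff_gap)
    show "u \<in> borel_measurable (lebesgue_on B)" using meas BO by (rule measurable_restrict_mono)
  qed (use M in \<open>auto simp: B_def\<close>)
  have "u z0 \<le> ereal (K / V) * ereal_integral B u"
    unfolding int
    by (subst submean_iff_gap) (use M R K V * in \<open>auto simp: g_def\<close>)
  then show ?thesis by (simp add: V_def B_def)
qed

section \<open>Separately quasi-nearly subharmonic functions\<close>

theorem theorem1:
  fixes \<Omega> :: "((real ^ 'm) \<times> (real ^ 'n)) set"
    and u :: "(real ^ 'm) \<times> (real ^ 'n) \<Rightarrow> ereal"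
    and K :: real
  assumes "CARD('m) \<ge> 2" and "CARD('n) \<ge> 2" and "K \<ge> 1"
    and "open \<Omega>" and "connected \<Omega>" and "\<Omega> \<noteq> {}"
    and "\<forall>z\<in>\<Omega>. u z < \<infinity>"
    and "u \<in> borel_measurable (lebesgue_on \<Omega>)"
    and "\<forall>y. quasi_nearly_subharmonic 1 {x. (x, y) \<in> \<Omega>} (\<lambda>x. u (x, y))"
    and "AE x in lebesgue. quasi_nearly_subharmonic_ns K {y. (x, y) \<in> \<Omega>} (\<lambda>y. u (x, y))"
    and "\<exists>\<psi>. permissible \<psi> \<and> \<not> \<psi> constant_on {0..} \<and> \<psi> \<circ> pos_part u \<in> L1_loc \<Omega>"
  shows "quasi_nearly_subharmonic_ns K \<Omega> u"
proof -
  note op = \<open>open \<Omega>\<close> and K = \<open>K \<ge> 1\<close> and meas = \<open>u \<in> borel_measurable (lebesgue_on \<Omega>)\<close>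
    and fin = \<open>\<forall>z\<in>\<Omega>. u z < \<infinity>\<close>
  have K0: "K > 0" using K by simp
  have sub1: "quasi_nearly_subharmonic 1 {x. (x, y) \<in> \<Omega>} (\<lambda>x. u (x, y))" for y
    using assms(9) by blast
  note sub2 = assms(10)
  obtain \<psi> where \<psi>: "permissible \<psi>" "\<not> \<psi> constant_on {0..}" "\<psi> \<circ> pos_part u \<in> L1_loc \<Omega>"
    using assms(11) by blast
  obtain A p :: real where A: "A \<ge> 0" and p: "0 < p" "p \<le> 1"
    and growth: "\<And>t. t \<ge> 0 \<Longrightarrow> t powr p \<le> A * (1 + \<psi> t)"
    using permissible_power_growth[OF \<psi>(1,2)] by metis
  have int: "(\<integral>\<^sup>+z\<in>C. ennreal (pos_part u z powr p) \<partial>lebesgue) < \<infinity>"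
    if "compact C" "C \<subseteq> \<Omega>" for C
    using L1_loc_permissible_imp_powr[OF \<psi>(3) A growth that] by simp
  have loc: "\<exists>U L. open U \<and> z \<in> U \<and> (\<forall>w\<in>U. pos_part u w \<le> L)" if "z \<in> \<Omega>" for z
    using separately_submean_locally_bounded[OF op K0 p meas sub1 sub2 int that] .
  have bdd: "\<exists>L\<ge>0. \<forall>z\<in>C. pos_part u z \<le> L" if C: "compact C" "C \<subseteq> \<Omega>" for C
  proof -
    have "\<exists>U L. open U \<and> z \<in> U \<and> (\<forall>w\<in>U. pos_part u w \<le> L)" if "z \<in> C" for z
      by (rule loc) (rule subsetD[OF C(2) that])
    then obtain L where "L \<ge> 0" "\<And>z. z \<in> C \<Longrightarrow> pos_part u z \<le> L"
      using locally_bounded_imp_bounded_on_compact[OF C(1)] by metis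
    then show ?thesis by auto
  qed
  have "pos_part u \<in> L1_loc \<Omega>"
  proof (rule bounded_pos_part_L1_loc[OF meas])
    fix C assume "compact C" "C \<subseteq> \<Omega>"
    from bdd[OF this] show "\<exists>L. \<forall>z\<in>C. pos_part u z \<le> L" by auto
  qed
  then have adm: "qns_admissible \<Omega> u"
    unfolding qns_admissible_def using op fin meas by simp
  have "u z \<le> ereal (K / (measure lebesgue (ball (0::(real ^ 'm) \<times> (real ^ 'n)) 1)
      * r ^ DIM((real ^ 'm) \<times> (real ^ 'n)))) * ereal_integral (ball z r) u"
    if r: "r > 0" "cball z r \<subseteq> \<Omega>" for z r
  proof -
    obtain M where M: "M \<ge> 0" "\<And>w. w \<in> cball z r \<Longrightarrow> pos_part u w \<le> M"
      using bdd[OF compact_cball r(2)] by auto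
    have "u w \<le> ereal M" if "w \<in> cball z r" for w
    proof -
      have "u w \<le> ereal (pos_part u w)" using fin r that by (intro le_pos_part) auto
      also have "\<dots> \<le> ereal M" using M(2)[OF that] by simp
      finally show ?thesis .
    qed
    then have "u z \<le> ereal (K / measure lebesgue (ball z r)) * ereal_integral (ball z r) u"
      by (rule separately_submean_ball[OF op K0 meas sub1 sub2 r M(1)])
    then show ?thesis using r by (subst (asm) measure_lebesgue_ball) auto
  qed
  then show ?thesis using adm unfolding quasi_nearly_subharmonic_ns_def by simp
qed

end
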